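(* Let $l:\mathbb{C}\to(0,+\infty)$ be continuous and such that, for every $\theta\in[0,2\pi]$, $u(r,\theta)=l(re^{i\theta})$ is a positive continuously differentiable function of $r\in[0,+\infty)$. If an entire function $f:\mathbb{C}\to\mathbb{C}$ has bounded $l$-index $N=N(f,l)$ and there exists $C>0$ such that $$\varlimsup_{r\to+\infty}\ \max_{\theta\in[0,2\pi]}\frac{(-u'_r(r,\theta))^+}{l^2(re^{i\theta})}=C,$$ then $$\varlimsup_{r\to+\infty}\frac{\ln\max\{|f(z)|:|z|=r\}}{\max\limits_{\theta\in[0,2\pi]}\int_0^r l(\tau e^{i\theta})\,d\tau}\le(C+1)N+1.$$
   Context: $a^+=\max\{a,0\}$ for $a\in\mathbb{R}$; $u'_r$ is the partial derivative of $u$ in $r$. An entire function $f$ is of bounded $l$-index if there exists an integer $m\ge0$ such that for all integers $p\ge0$ and all $z\in\mathbb{C}$, $\frac{|f^{(p)}(z)|}{p!\,l^p(z)}\le\max\left\{\frac{|f^{(s)}(z)|}{s!\,l^s(z)}:0\le s\le m\right\}$. The least such $m$ is called the $l$-index of $f$ and denoted $N(f,l)$. *)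

theory Defs
  imports "HOL-Complex_Analysis.Complex_Analysis"
begin

definition l_index_bound :: "(complex \<Rightarrow> real) \<Rightarrow> (complex \<Rightarrow> complex) \<Rightarrow> nat \<Rightarrow> bool" where
  "l_index_bound l f m \<longleftrightarrow>
     (\<forall>p z. norm ((deriv ^^ p) f z) / (fact p * l z ^ p)
        \<le> Max ((\<lambda>s. norm ((deriv ^^ s) f z) / (fact s * l z ^ s)) ` {0..m}))"

definition bounded_l_index :: "(complex \<Rightarrow> real) \<Rightarrow> (complex \<Rightarrow> complex) \<Rightarrow> bool" where
  "bounded_l_index l f \<longleftrightarrow> f holomorphic_on UNIV \<and> (\<exists>m. l_index_bound l f m)"

text \<open>Only meaningful under \<open>bounded_l_index l f\<close>; otherwise the value is unspecified.\<close>

definition l_index :: "(complex \<Rightarrow> real) \<Rightarrow> (complex \<Rightarrow> complex) \<Rightarrow> nat" where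
  "l_index l f = (LEAST m. l_index_bound l f m)"

end

theory Submission
  imports Defs
begin

text \<open>Along each ray the quantities
  \<open>v\<^sub>s(t) = (|f\<^sup>(\<^sup>s\<^sup>)(t e\<^sup>i\<^sup>\<theta>)| / (s! u(t)\<^sup>s))\<^sup>2\<close> for \<open>s \<le> N\<close> satisfy
  \<open>v\<^sub>s' \<le> 2 ((s + 1) u + s (-u')\<^sup>+ / u) v\<^sub>s\<close> whenever \<open>v\<^sub>s\<close> is the largest of them, since the
  index bound controls the derivative of order \<open>s + 1\<close>. A Gronwall argument for the maximum of the
  \<open>v\<^sub>s\<close> then gives \<open>|f| \<le> A exp (K \<integral> u)\<close> with \<open>K\<close> close to \<open>(C + 1) N + 1\<close>. The constant \<open>A\<close> is
  negligible because \<open>(1/u)' \<le> c\<close> forces \<open>u(r) \<ge> 1 / (a + c r)\<close>, so the integral diverges.\<close>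

section \<open>Gronwall inequality for the maximum of a finite family\<close>

text \<open>The maximum over index and time together is attained by some \<open>G i\<close> at some
  \<open>x i\<close>. If \<open>x i > a\<close>, then \<open>i\<close> is maximal at that time, so
  \<open>G i\<close> has negative derivative there and was larger just before, a contradiction.
  Working with this joint maximum avoids differentiating the pointwise maximum of the family, which
  need not be differentiable.\<close>

lemma finite_family_le_initial:
  fixes G G' :: "'i \<Rightarrow> real \<Rightarrow> real"
  assumes I: "finite I"
    and deriv: "\<And>s t. s \<in> I \<Longrightarrow> t \<in> {a..b} \<Longrightarrow> (G s has_real_derivative G' s t) (at t within {a..b})"
    and neg: "\<And>s t. s \<in> I \<Longrightarrow> t \<in> {a..b} \<Longrightarrow> (\<And>j. j \<in> I \<Longrightarrow> G j t \<le> G s t) \<Longrightarrow> G' s t < 0"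
    and bound: "\<And>j. j \<in> I \<Longrightarrow> G j a \<le> M"
    and s: "s \<in> I" and t: "t \<in> {a..b}"
  shows "G s t \<le> M"
proof -
  have "\<exists>x\<in>{a..b}. \<forall>y\<in>{a..b}. G j y \<le> G j x" if "j \<in> I" for j
  proof (rule continuous_attains_sup)
    show "continuous_on {a..b} (G j)"
      using deriv[OF that] by (meson DERIV_continuous continuous_on_eq_continuous_within)
  qed (use t in auto)
  then obtain x where x: "\<And>j. j \<in> I \<Longrightarrow> x j \<in> {a..b}"
      "\<And>j y. j \<in> I \<Longrightarrow> y \<in> {a..b} \<Longrightarrow> G j y \<le> G j (x j)"
    by metis
  define P where "P = (\<lambda>j. G j (x j)) ` I"
  have fin: "finite P" "P \<noteq> {}" using I s by (auto simp: P_def)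
  from Max_in[OF fin] obtain i where i: "i \<in> I" "Max P = G i (x i)" by (auto simp: P_def)
  have glob: "G j y \<le> G i (x i)" if "j \<in> I" "y \<in> {a..b}" for j y
  proof -
    have "G j (x j) \<le> Max P" using that fin by (intro Max_ge) (auto simp: P_def)
    with x(2)[OF that] i(2) show ?thesis by linarith
  qed
  have "x i = a"
  proof (rule ccontr)
    assume "x i \<noteq> a"
    with x(1)[OF i(1)] have xi: "a < x i" "x i \<le> b" by auto
    have "G' i (x i) < 0"
      using neg[OF i(1) x(1)[OF i(1)]] glob[OF _ x(1)[OF i(1)]] by blast
    from has_real_derivative_neg_dec_left[OF deriv[OF i(1) x(1)[OF i(1)]] this]
    obtain d where d: "d > 0" "\<And>h. h > 0 \<Longrightarrow> x i - h \<in> {a..b} \<Longrightarrow> h < d \<Longrightarrow> G i (x i) < G i (x i - h)"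
      by blast
    define h where "h = min (d / 2) (x i - a)"
    have h: "h > 0" "x i - h \<in> {a..b}" "h < d" using d(1) xi by (auto simp: h_def)
    from d(2)[OF h] glob[OF i(1) h(2)] show False by linarith
  qed
  with glob[OF s t] bound[OF i(1)] show ?thesis by simp
qed

text \<open>The usual integrating factor \<open>exp (W a - W t)\<close> reduces this to the previous
  lemma. It is positive and the same for every index, and so is the subtracted linear term; hence
  the modified family has the same maximal indices as \<open>G\<close> at each time, and
  \<open>le\<close> applies exactly where it is needed.\<close>

lemma finite_family_gronwall:
  fixes G G' :: "'i \<Rightarrow> real \<Rightarrow> real" and W k :: "real \<Rightarrow> real"
  assumes I: "finite I"
    and deriv: "\<And>s t. s \<in> I \<Longrightarrow> t \<in> {a..b} \<Longrightarrow> (G s has_real_derivative G' s t) (at t within {a..b})"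
    and W: "\<And>t. t \<in> {a..b} \<Longrightarrow> (W has_real_derivative k t) (at t within {a..b})"
    and le: "\<And>s t. s \<in> I \<Longrightarrow> t \<in> {a..b} \<Longrightarrow> (\<And>j. j \<in> I \<Longrightarrow> G j t \<le> G s t) \<Longrightarrow> G' s t \<le> k t * G s t"
    and bound: "\<And>j. j \<in> I \<Longrightarrow> G j a \<le> M"
    and s: "s \<in> I" and ab: "a \<le> b"
  shows "G s b \<le> M * exp (W b - W a)"
proof -
  have "G s b * exp (W a - W b) \<le> M + e" if e: "e > 0" for e
  proof -
    \<comment> \<open>The linear term makes the derivative at a maximal index strictly negative.\<close>
    define \<eta> where "\<eta> = e / (b - a + 1)"
    have \<eta>: "\<eta> > 0" using e ab by (simp add: \<eta>_def)
    define H where "H j t = G j t * exp (W a - W t) - \<eta> * (t - a)" for j t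
    define H' where "H' j t = (G' j t - k t * G j t) * exp (W a - W t) - \<eta>" for j t
    have "H s b \<le> M"
    proof (rule finite_family_le_initial[OF I, where G = H and G' = H' and a = a and b = b])
      show "(H j has_real_derivative H' j t) (at t within {a..b})"
        if "j \<in> I" "t \<in> {a..b}" for j t
        unfolding H_def H'_def
        by (rule derivative_eq_intros deriv[OF that] W[OF that(2)] refl
            | simp add: algebra_simps)+
      show "H' j t < 0" if "j \<in> I" "t \<in> {a..b}" "\<And>i. i \<in> I \<Longrightarrow> H i t \<le> H j t" for j t
      proof -
        have "G' j t \<le> k t * G j t"
          using le[OF that(1,2)] that(3) by (simp add: H_def)
        then have "(G' j t - k t * G j t) * exp (W a - W t) \<le> 0"
          by (intro mult_nonpos_nonneg) auto
        with \<eta> show ?thesis by (simp add: H'_def)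
      qed
    qed (use bound s ab in \<open>auto simp: H_def\<close>)
    \<comment> \<open>The \<open>+ 1\<close> in the denominator of \<eta> allows
      \<open>a = b\<close>; the linear term still costs at most \<open>e\<close>.\<close>
    moreover have "\<eta> * (b - a) \<le> e"
      using e ab by (simp add: \<eta>_def field_simps)
    ultimately show ?thesis by (simp add: H_def)
  qed
  then have "G s b * exp (W a - W b) \<le> M" by (rule field_le_epsilon)
  then have "G s b * exp (W a - W b) * exp (W b - W a) \<le> M * exp (W b - W a)"
    by (intro mult_right_mono) auto
  then show ?thesis by (simp add: mult.assoc flip: exp_add)
qed

section \<open>Divergence of the integral along a ray\<close>

text \<open>Since \<open>(1/v)' = - v'/v^2\<close> is at most \<open>c\<close>, \<open>1/v\<close>
  stays below the affine function \<open>q\<close> that agrees with it at \<open>R\<close> and has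
  slope \<open>c\<close>. Therefore \<open>W' = v >= 1/q = (ln q / c)'\<close>, and \<open>W\<close>
  grows at least logarithmically.\<close>

lemma integral_at_top_of_deriv_inverse_bounded:
  fixes v v' :: "real \<Rightarrow> real"
  assumes deriv: "\<And>t. R \<le> t \<Longrightarrow> (v has_real_derivative v' t) (at t within {R..})"
    and pos: "\<And>t. R \<le> t \<Longrightarrow> 0 < v t"
    and W: "\<And>t. R \<le> t \<Longrightarrow> (W has_real_derivative v t) (at t within {R..})"
    and c: "c > 0" and le: "\<And>t. R \<le> t \<Longrightarrow> - v' t / (v t)\<^sup>2 \<le> c"
  shows "filterlim W at_top at_top"
proof -
  define q where "q t = 1 / v R + c * (t - R)" for t
  have q_pos: "q t > 0" if "R \<le> t" for t
    using pos[of R] c that by (auto simp: q_def intro!: add_pos_nonneg)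
  have inv_le: "1 / v t \<le> q t" if t: "R \<le> t" for t
  proof -
    \<comment> \<open>The hypotheses give only a one-sided derivative at \<open>R\<close>. The
      monotonicity criterion needs derivatives at interior points alone, together with continuity up
      to the endpoints.\<close>
    have "(\<lambda>x. q x - 1 / v x) R \<le> (\<lambda>x. q x - 1 / v x) t"
    proof (rule DERIV_nonneg_imp_increasing_open[OF t])
      show "\<exists>y. ((\<lambda>x. q x - 1 / v x) has_real_derivative y) (at x) \<and> 0 \<le> y"
        if x: "R < x" "x < t" for x
      proof -
        have "(v has_real_derivative v' x) (at x)"
          using has_field_derivative_subset[OF deriv[of x], of "{R<..}"] x
          by (simp add: at_within_open[of x "{R<..}"] subset_eq)
        moreover have "v x \<noteq> 0" using pos[of x] x by simp
        ultimately have "((\<lambda>x. q x - 1 / v x) has_real_derivative c + v' x / (v x)\<^sup>2) (at x)"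
          unfolding q_def
          by (auto intro!: derivative_eq_intros simp: power2_eq_square)
        with le[of x] x show ?thesis by (intro exI conjI) auto
      qed
      have "continuous_on {R..t} v"
        by (rule continuous_on_subset[of "{R..}"])
           (use deriv in \<open>auto simp: continuous_on_eq_continuous_within intro: DERIV_continuous\<close>)
      then show "continuous_on {R..t} (\<lambda>x. q x - 1 / v x)"
        unfolding q_def using pos
        by (intro continuous_intros) (auto simp: less_imp_neq[THEN not_sym])
    qed
    then show ?thesis by (simp add: q_def)
  qed
  have lower: "ln (q t) / c + (W R - ln (q R) / c) \<le> W t" if t: "R \<le> t" for t
  proof -
    have "(\<lambda>x. W x - ln (q x) / c) R \<le> (\<lambda>x. W x - ln (q x) / c) t"
    proof (rule DERIV_nonneg_imp_increasing_open[OF t])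
      show "\<exists>y. ((\<lambda>x. W x - ln (q x) / c) has_real_derivative y) (at x) \<and> 0 \<le> y"
        if x: "R < x" "x < t" for x
      proof -
        have "(W has_real_derivative v x) (at x)"
          using has_field_derivative_subset[OF W[of x], of "{R<..}"] x
          by (simp add: at_within_open[of x "{R<..}"] subset_eq)
        moreover have "((\<lambda>x. ln (q x)) has_real_derivative c / q x) (at x)"
          using q_pos[of x] x unfolding q_def by (auto intro!: derivative_eq_intros)
        ultimately have "((\<lambda>x. W x - ln (q x) / c) has_real_derivative v x - (c / q x) / c) (at x)"
          by (intro DERIV_diff DERIV_cdivide)
        moreover have "1 / q x \<le> v x"
          using inv_le[of x] q_pos[of x] pos[of x] x by (simp add: field_simps)
        ultimately show ?thesis using c by (intro exI conjI) auto
      qed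
      have "continuous_on {R..t} W"
        by (rule continuous_on_subset[of "{R..}"])
           (use W in \<open>auto simp: continuous_on_eq_continuous_within intro: DERIV_continuous\<close>)
      moreover have "continuous_on {R..t} q" unfolding q_def by (intro continuous_intros)
      ultimately show "continuous_on {R..t} (\<lambda>x. W x - ln (q x) / c)"
        using q_pos c by (intro continuous_intros) (auto simp: less_imp_neq[THEN not_sym])
    qed
    then show ?thesis by simp
  qed
  have "filterlim (\<lambda>t. ln (q t) / c + (W R - ln (q R) / c)) at_top at_top"
    unfolding q_def using c by real_asymp
  then show ?thesis
    by (rule filterlim_at_top_mono)
       (use lower in \<open>auto simp: eventually_at_top_linorder\<close>)
qed

section \<open>Growth of the normalized derivatives along a ray\<close>

text \<open>Squaring makes the quotient differentiable even at zeros of the \<open>s\<close>-th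
  derivative, where the norm itself may fail to be: the squared norm is an inner product of a smooth
  curve with itself. The first term comes from the numerator, the second from the weight.\<close>

lemma norm_higher_deriv_sq_ray_deriv:
  fixes v :: "real \<Rightarrow> real"
  assumes f: "f holomorphic_on UNIV"
    and v: "(v has_real_derivative v') (at t within T)" and pos: "0 < v t"
  shows "((\<lambda>x. (norm ((deriv ^^ s) f (of_real x * w)) / (fact s * v x ^ s))\<^sup>2) has_real_derivative
      2 * ((deriv ^^ s) f (of_real t * w) \<bullet> ((deriv ^^ Suc s) f (of_real t * w) * w))
        / (fact s * v t ^ s)\<^sup>2
      - 2 * real s * (v' / v t) * (norm ((deriv ^^ s) f (of_real t * w)) / (fact s * v t ^ s))\<^sup>2)
      (at t within T)"
proof -
  define F where "F x = (deriv ^^ s) f (of_real x * w)" for x :: real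
  have "(deriv ^^ s) f holomorphic_on UNIV" using f by (intro holomorphic_higher_deriv) auto
  then have "((deriv ^^ s) f has_field_derivative (deriv ^^ Suc s) f z) (at z)" for z
    using holomorphic_derivI[of "(deriv ^^ s) f" UNIV z] by simp
  moreover have "((\<lambda>x. of_real x * w) has_vector_derivative w) (at t within T)"
    by (auto intro!: derivative_eq_intros simp: has_vector_derivative_def scaleR_conv_of_real)
  ultimately have "(F has_vector_derivative w * (deriv ^^ Suc s) f (of_real t * w)) (at t within T)"
    using field_vector_diff_chain_within[of "\<lambda>x. of_real x * w" w t T "(deriv ^^ s) f"
        "(deriv ^^ Suc s) f (of_real t * w)"]
    unfolding F_def o_def by (meson has_field_derivative_at_within)
  from bounded_bilinear.has_vector_derivative[OF bounded_bilinear_inner this this]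
  have F2: "((\<lambda>x. F x \<bullet> F x) has_real_derivative
      2 * (F t \<bullet> ((deriv ^^ Suc s) f (of_real t * w) * w))) (at t within T)"
    by (simp add: has_real_derivative_iff_has_vector_derivative inner_commute mult.commute)
  have nz: "v t \<noteq> 0" using pos by simp
  have den: "((\<lambda>x. (fact s * v x ^ s)\<^sup>2) has_real_derivative
      2 * real s * (v' / v t) * (fact s * v t ^ s)\<^sup>2) (at t within T)"
  proof -
    have "((\<lambda>x. (fact s * v x ^ s)\<^sup>2) has_real_derivative
        2 * (fact s * v t ^ s) * (fact s * (real s * v t ^ (s - 1) * v'))) (at t within T)"
      (is "(_ has_real_derivative ?d) _")
      by (auto intro!: derivative_eq_intros v)
    moreover
    \<comment> \<open>For \<open>s = 0\<close> the truncated exponent \<open>s - 1\<close> is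
      harmless, because the factor \<open>real s\<close> makes both sides vanish.\<close>
    have "real s * v t ^ (s - 1) * v' = real s * (v' / v t) * v t ^ s"
      using nz by (cases s) (simp_all del: of_nat_Suc)
    then have "?d = 2 * real s * (v' / v t) * (fact s * v t ^ s)\<^sup>2"
      by (simp only: power2_eq_square mult_ac)
    ultimately show ?thesis by (rule DERIV_cong)
  qed
  have "((\<lambda>x. (F x \<bullet> F x) / (fact s * v x ^ s)\<^sup>2) has_real_derivative
      2 * (F t \<bullet> ((deriv ^^ Suc s) f (of_real t * w) * w)) / (fact s * v t ^ s)\<^sup>2
      - 2 * real s * (v' / v t) * ((F t \<bullet> F t) / (fact s * v t ^ s)\<^sup>2)) (at t within T)"
  proof -
    define d where "d = (fact s * v t ^ s)\<^sup>2"
    have d: "d \<noteq> 0" using nz by (simp add: d_def)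
    show ?thesis
      by (rule DERIV_cong[OF DERIV_divide[OF F2 den]])
         (use d nz in \<open>auto simp: d_def[symmetric] field_simps\<close>)
  qed
  then show ?thesis
    by (simp only: F_def dot_square_norm power_divide)
qed

lemma l_index_boundI:
  assumes "bounded_l_index l f"
  shows "l_index_bound l f (l_index l f)"
  using assms unfolding bounded_l_index_def l_index_def by (auto intro: LeastI)

text \<open>Source of the constant \<open>(c + 1) * N + 1\<close>: at a maximal index
  \<open>s\<close>, the numerator contributes the rate \<open>(s + 1) l\<close> and the decay of the
  weight contributes at most \<open>s c l\<close>, with sum \<open>((c + 1) s + 1) l\<close>. The
  bound \<open>A\<close> on all normalized derivatives at the starting point serves as initial
  value.\<close>

lemma norm_ray_le:
  fixes l :: "complex \<Rightarrow> real" and f :: "complex \<Rightarrow> complex"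
  assumes f: "f holomorphic_on UNIV" and index: "l_index_bound l f N"
    and l_pos: "\<And>z. 0 < l z" and w: "norm w = 1" and ab: "a \<le> b"
    and deriv: "\<And>t. t \<in> {a..b} \<Longrightarrow> ((\<lambda>x. l (of_real x * w)) has_real_derivative v' t) (at t within {a..b})"
    and W: "\<And>t. t \<in> {a..b} \<Longrightarrow> (W has_real_derivative l (of_real t * w)) (at t within {a..b})"
    and c: "0 \<le> c"
    and v': "\<And>t. t \<in> {a..b} \<Longrightarrow> - v' t / (l (of_real t * w))\<^sup>2 \<le> c"
    and A: "\<And>s. s \<le> N \<Longrightarrow> norm ((deriv ^^ s) f (of_real a * w)) / (fact s * l (of_real a * w) ^ s) \<le> A"
  shows "norm (f (of_real b * w)) \<le> A * exp (((c + 1) * real N + 1) * (W b - W a))"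
proof -
  define K where "K = (c + 1) * real N + 1"
  define v where "v x = l (of_real x * w)" for x
  define \<phi> where "\<phi> s x = norm ((deriv ^^ s) f (of_real x * w)) / (fact s * v x ^ s)" for s x
  define D where "D s t = 2 * ((deriv ^^ s) f (of_real t * w) \<bullet> ((deriv ^^ Suc s) f (of_real t * w) * w))
        / (fact s * v t ^ s)\<^sup>2 - 2 * real s * (v' t / v t) * (\<phi> s t)\<^sup>2" for s t
  have v_pos: "0 < v t" for t using l_pos by (simp add: v_def)
  have \<phi>_nonneg: "0 \<le> \<phi> s t" for s t using v_pos[of t] by (simp add: \<phi>_def)
  have D_le: "D s t \<le> (2 * K * v t) * (\<phi> s t)\<^sup>2"
    if s: "s \<in> {0..N}" and t: "t \<in> {a..b}" and max: "\<And>j. j \<in> {0..N} \<Longrightarrow> (\<phi> j t)\<^sup>2 \<le> (\<phi> s t)\<^sup>2" for s t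
  proof -
    have \<phi>_le: "\<phi> j t \<le> \<phi> s t" if "j \<in> {0..N}" for j
      using max[OF that] \<phi>_nonneg by (rule power2_le_imp_le)
    \<comment> \<open>The index bound is indispensable for \<open>s = N\<close>, where the
      derivative of order \<open>s + 1\<close> lies outside the family.\<close>
    have "\<phi> (Suc s) t \<le> Max ((\<lambda>s. \<phi> s t) ` {0..N})"
      using index unfolding l_index_bound_def \<phi>_def v_def by blast
    also have "\<dots> \<le> \<phi> s t" using \<phi>_le by (subst Max_le_iff) auto
    finally have next_le: "\<phi> (Suc s) t \<le> \<phi> s t" .
    have "(deriv ^^ s) f (of_real t * w) \<bullet> ((deriv ^^ Suc s) f (of_real t * w) * w)
        \<le> norm ((deriv ^^ s) f (of_real t * w)) * norm ((deriv ^^ Suc s) f (of_real t * w))"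
      using norm_cauchy_schwarz[of "(deriv ^^ s) f (of_real t * w)" "(deriv ^^ Suc s) f (of_real t * w) * w"] w
      by (simp only: norm_mult mult_1_right)
    \<comment> \<open>Raising the order by one multiplies the normalizing denominator by
      \<open>(s + 1) * v t\<close>; this is the origin of the rate.\<close>
    also have "\<dots> = (fact s * v t ^ s)\<^sup>2 * (\<phi> s t * (real (Suc s) * v t * \<phi> (Suc s) t))"
    proof -
      define d where "d = fact s * v t ^ s"
      define e where "e = real (Suc s) * v t"
      have nz: "d \<noteq> 0" "e \<noteq> 0" using v_pos[of t] by (simp_all add: d_def e_def)
      have "fact (Suc s) * v t ^ Suc s = d * e" by (simp add: d_def e_def mult_ac)
      then have "norm ((deriv ^^ Suc s) f (of_real t * w)) = d * (e * \<phi> (Suc s) t)"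
        using nz unfolding \<phi>_def by simp
      moreover have "norm ((deriv ^^ s) f (of_real t * w)) = d * \<phi> s t"
        using nz unfolding \<phi>_def d_def by simp
      ultimately show ?thesis
        unfolding d_def[symmetric] e_def[symmetric] by (simp add: power2_eq_square mult_ac)
    qed
    also have "\<dots> \<le> (fact s * v t ^ s)\<^sup>2 * (\<phi> s t * (real (Suc s) * v t * \<phi> s t))"
      using next_le \<phi>_nonneg v_pos[of t] by (intro mult_left_mono) auto
    finally have "2 * ((deriv ^^ s) f (of_real t * w) \<bullet> ((deriv ^^ Suc s) f (of_real t * w) * w))
        / (fact s * v t ^ s)\<^sup>2 \<le> 2 * (real (Suc s) * v t * (\<phi> s t)\<^sup>2)"
      using v_pos[of t]
      by (simp add: pos_divide_le_eq power2_eq_square mult_ac del: funpow.simps of_nat_Suc)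
    moreover have "real s * (- v' t / v t) * (\<phi> s t)\<^sup>2 \<le> real s * (c * v t) * (\<phi> s t)\<^sup>2"
    proof -
      have "- v' t / (v t)\<^sup>2 \<le> c" using v'[OF t] by (simp only: v_def)
      then have "- v' t / v t \<le> c * v t"
        using v_pos[of t] by (simp add: field_simps power2_eq_square)
      then show ?thesis by (intro mult_right_mono mult_left_mono) auto
    qed
    ultimately have "D s t \<le> 2 * (real (Suc s) + real s * c) * v t * (\<phi> s t)\<^sup>2"
      by (simp add: D_def algebra_simps del: funpow.simps)
    \<comment> \<open>The coefficient equals \<open>2 * ((c + 1) * s + 1)\<close>, which is largest
      at \<open>s = N\<close>.\<close>
    also have "\<dots> \<le> 2 * K * v t * (\<phi> s t)\<^sup>2"
    proof -
      have "real s * (c + 1) \<le> real N * (c + 1)" using s c by (intro mult_right_mono) auto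
      then show ?thesis using v_pos[of t]
        by (intro mult_right_mono mult_left_mono) (auto simp: K_def algebra_simps)
    qed
    finally show ?thesis by simp
  qed
  \<comment> \<open>The rate is \<open>2 * K\<close> because the family consists of squares; taking
    the root restores \<open>K\<close>. Index 0 carries no weight, so it is the norm of
    \<open>f\<close> itself.\<close>
  have "(\<phi> 0 b)\<^sup>2 \<le> A\<^sup>2 * exp (2 * K * W b - 2 * K * W a)"
  proof (rule finite_family_gronwall[where I = "{0..N}" and G = "\<lambda>s t. (\<phi> s t)\<^sup>2" and G' = D
        and W = "\<lambda>t. 2 * K * W t" and k = "\<lambda>t. 2 * K * v t"])
    show "((\<lambda>t. (\<phi> s t)\<^sup>2) has_real_derivative D s t) (at t within {a..b})" if "t \<in> {a..b}" for s t
      using norm_higher_deriv_sq_ray_deriv[OF f, of v "v' t" t "{a..b}" s w] deriv[OF that] v_pos[of t]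
      unfolding \<phi>_def D_def v_def by blast
    show "((\<lambda>t. 2 * K * W t) has_real_derivative 2 * K * v t) (at t within {a..b})" if "t \<in> {a..b}" for t
      using W[OF that] unfolding v_def by (rule DERIV_cmult)
    show "(\<phi> j a)\<^sup>2 \<le> A\<^sup>2" if "j \<in> {0..N}" for j
      using A[of j] that \<phi>_nonneg[of j a] by (intro power_mono) (auto simp: \<phi>_def v_def)
  qed (use D_le ab in auto)
  also have "\<dots> = (A * exp (K * (W b - W a)))\<^sup>2"
    by (simp add: power_mult_distrib exp_double[symmetric] algebra_simps)
  finally have "\<phi> 0 b \<le> A * exp (K * (W b - W a))"
  proof (rule power2_le_imp_le)
    have "0 \<le> A" using order.trans[OF norm_ge_zero, of "f (of_real a * w)" A] A[of 0] by simp
    then show "0 \<le> A * exp (K * (W b - W a))" by simp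
  qed
  then show ?thesis by (simp add: \<phi>_def K_def)
qed

section \<open>From growth along rays to the upper limit\<close>

theorem corollary3:
  fixes l :: "complex \<Rightarrow> real"
    and u u' :: "real \<Rightarrow> real \<Rightarrow> real"
    and f :: "complex \<Rightarrow> complex"
    and N :: nat
    and C :: real
  assumes l_cont: "continuous_on UNIV l"
    and l_pos: "\<And>z. 0 < l z"
    and u_eq: "\<And>r \<theta>. u r \<theta> = l (of_real r * exp (\<i> * of_real \<theta>))"
    and u_deriv: "\<And>r \<theta>. 0 \<le> r \<Longrightarrow> \<theta> \<in> {0..2 * pi} \<Longrightarrow>
      ((\<lambda>t. u t \<theta>) has_real_derivative u' r \<theta>) (at r within {0..})"
    and u'_cont: "\<And>\<theta>. \<theta> \<in> {0..2 * pi} \<Longrightarrow> continuous_on {0..} (\<lambda>r. u' r \<theta>)"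
    and f_entire: "f holomorphic_on UNIV"
    and f_index: "bounded_l_index l f"
    and N_eq: "N = l_index l f"
    and C_pos: "0 < C"
    and limsup_C: "Limsup at_top (\<lambda>r::real. SUP \<theta>\<in>{0..2 * pi}.
      ereal (max (- u' r \<theta>) 0 / (l (of_real r * exp (\<i> * of_real \<theta>)))\<^sup>2)) = ereal C"
  shows "Limsup at_top (\<lambda>r::real.
      ereal (ln (SUP z\<in>{z. norm z = r}. norm (f z)) /
        (SUP \<theta>\<in>{0..2 * pi}. integral {0..r} (\<lambda>\<tau>. l (of_real \<tau> * exp (\<i> * of_real \<theta>))))))
    \<le> ereal ((C + 1) * real N + 1)"
proof -
  define ray where "ray \<theta> = exp (\<i> * of_real \<theta>)" for \<theta> :: real
  define J where "J \<theta> r = integral {0..r} (\<lambda>\<tau>. l (of_real \<tau> * ray \<theta>))" for \<theta> r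
  define I where "I r = (SUP \<theta>\<in>{0..2 * pi}. J \<theta> r)" for r
  define M where "M r = (SUP z\<in>{z. norm z = r}. norm (f z))" for r
  define K where "K = (C + 1) * real N + 1"
  have norm_ray: "norm (ray \<theta>) = 1" for \<theta> by (simp add: ray_def)
  have index: "l_index_bound l f N" using l_index_boundI[OF f_index] N_eq by simp
  have l_ray_cont: "continuous_on S (\<lambda>\<tau>. l (of_real \<tau> * ray \<theta>))" for S \<theta>
    by (rule continuous_on_compose2[OF l_cont]) (auto intro!: continuous_intros)
  have J_deriv: "(J \<theta> has_real_derivative l (of_real t * ray \<theta>)) (at t within {0..})" if t: "0 \<le> t" for \<theta> t
  proof -
    have "(J \<theta> has_real_derivative l (of_real t * ray \<theta>)) (at t within {0..t + 1})"
      unfolding J_def by (rule integral_has_real_derivative[OF l_ray_cont]) (use t in auto)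
    moreover have "at t within {0..t + 1} = at t within {0..}"
      by (rule at_within_nhd[of t "{..<t + 1}"]) auto
    ultimately show ?thesis by simp
  qed
  have J_le: "J \<theta> r \<le> I r" if \<theta>: "\<theta> \<in> {0..2 * pi}" and r: "0 \<le> r" for \<theta> r
    unfolding I_def
  proof (rule cSUP_upper[OF \<theta>])
    \<comment> \<open>A real \<open>SUP\<close> dominates its members only if they are bounded
      above. A bound for \<open>l\<close> on the closed disc works for all directions at
      once.\<close>
    have "compact (l ` cball 0 r)"
      by (intro compact_continuous_image continuous_on_subset[OF l_cont]) auto
    then have "bdd_above (l ` cball 0 r)"
      by (intro bounded_imp_bdd_above compact_imp_bounded)
    then obtain B where B: "\<And>z. norm z \<le> r \<Longrightarrow> l z \<le> B"
      unfolding bdd_above_def by (metis mem_cball_0 imageI)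
    have "J \<theta> r \<le> integral {0..r} (\<lambda>_. B)" for \<theta>
      unfolding J_def
      by (intro integral_le integrable_continuous_real l_ray_cont)
         (auto intro!: B simp: norm_mult norm_ray)
    then show "bdd_above ((\<lambda>\<theta>. J \<theta> r) ` {0..2 * pi})"
      by (auto intro!: bdd_aboveI)
  qed
  have J_nonneg: "0 \<le> J \<theta> r" for \<theta> r
    unfolding J_def by (intro integral_nonneg integrable_continuous_real l_ray_cont) (simp add: l_pos less_imp_le)

  have main: "\<forall>\<^sub>F r in at_top. ln (M r) / I r \<le> K + e" if e: "e > 0" for e
  proof -
    \<comment> \<open>Multiplied by \<open>N\<close>, the excess of \<open>c\<close> over
      \<open>C\<close> stays below \<open>e / 2\<close>, also for \<open>N = 0\<close> thanks to the
      \<open>+ 1\<close>. The other \<open>e / 2\<close> is kept for absorbing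
      \<open>ln A\<close>.\<close>
    define c where "c = C + e / (2 * (real N + 1))"
    have "C < c" using e by (simp add: c_def)
    have c_pos: "0 < c" using C_pos \<open>C < c\<close> by simp
    have K_c: "(c + 1) * real N + 1 \<le> K + e / 2"
      using e by (simp add: c_def K_def field_simps)
    have "\<forall>\<^sub>F r in at_top. (SUP \<theta>\<in>{0..2 * pi}. ereal (max (- u' r \<theta>) 0 /
        (l (of_real r * exp (\<i> * of_real \<theta>)))\<^sup>2)) < ereal c"
      by (rule Limsup_lessD) (use limsup_C \<open>C < c\<close> in simp)
    then obtain R0 where R0: "\<And>r. r \<ge> R0 \<Longrightarrow> (SUP \<theta>\<in>{0..2 * pi}. ereal (max (- u' r \<theta>) 0 /
        (l (of_real r * exp (\<i> * of_real \<theta>)))\<^sup>2)) < ereal c"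
      by (auto simp: eventually_at_top_linorder)
    define R where "R = max R0 0"
    have R: "0 \<le> R" by (simp add: R_def)
    have slope: "- u' r \<theta> / (l (of_real r * ray \<theta>))\<^sup>2 \<le> c" if "R \<le> r" "\<theta> \<in> {0..2 * pi}" for r \<theta>
    proof -
      have "ereal (max (- u' r \<theta>) 0 / (l (of_real r * ray \<theta>))\<^sup>2) \<le> ereal c"
        unfolding ray_def
        by (rule order.trans[OF SUP_upper[OF that(2)] less_imp_le[OF R0]]) (use that in \<open>simp add: R_def\<close>)
      then have "max (- u' r \<theta>) 0 / (l (of_real r * ray \<theta>))\<^sup>2 \<le> c" by simp
      moreover have "- u' r \<theta> / (l (of_real r * ray \<theta>))\<^sup>2 \<le> max (- u' r \<theta>) 0 / (l (of_real r * ray \<theta>))\<^sup>2"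
        by (intro divide_right_mono) auto
      ultimately show ?thesis by linarith
    qed
    have l_deriv: "((\<lambda>x. l (of_real x * ray \<theta>)) has_real_derivative u' t \<theta>) (at t within {R..})"
      if "R \<le> t" "\<theta> \<in> {0..2 * pi}" for t \<theta>
      using has_field_derivative_subset[OF u_deriv[of t \<theta>], of "{R..}"] that R
      by (simp add: u_eq ray_def)
    have J_deriv_R: "(J \<theta> has_real_derivative l (of_real t * ray \<theta>)) (at t within {R..})" if "R \<le> t" for t \<theta>
      using has_field_derivative_subset[OF J_deriv[of t \<theta>], of "{R..}"] that R by simp
    \<comment> \<open>Divergence in the single direction 0 suffices, since \<open>I\<close>
      dominates \<open>J 0\<close>.\<close>
    have "filterlim (J 0) at_top at_top"
      by (rule integral_at_top_of_deriv_inverse_bounded[where R = R and c = c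
            and v = "\<lambda>t. l (of_real t * ray 0)" and v' = "\<lambda>t. u' t 0"])
         (use l_deriv[of _ 0] J_deriv_R[of _ 0] slope[of _ 0] l_pos c_pos in auto)
    then have I_at_top: "filterlim I at_top at_top"
      by (rule filterlim_at_top_mono)
         (use J_le[of 0] in \<open>auto simp: eventually_at_top_linorder intro!: exI[of _ 0]\<close>)

    \<comment> \<open>The initial constant must not depend on the direction; compactness of the
      circle of radius \<open>R\<close> provides this.\<close>
    have "\<exists>B. \<forall>z. norm z = R \<longrightarrow> norm ((deriv ^^ s) f z) / (fact s * l z ^ s) \<le> B" for s
    proof -
      have "(deriv ^^ s) f holomorphic_on UNIV" using f_entire by (intro holomorphic_higher_deriv) auto
      then have "continuous_on (sphere 0 R) (\<lambda>z. norm ((deriv ^^ s) f z) / (fact s * l z ^ s))"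
        by (intro continuous_intros continuous_on_subset[OF l_cont]
              continuous_on_subset[OF holomorphic_on_imp_continuous_on])
           (auto simp: l_pos less_imp_neq[THEN not_sym])
      then have "compact ((\<lambda>z. norm ((deriv ^^ s) f z) / (fact s * l z ^ s)) ` sphere 0 R)"
        by (intro compact_continuous_image) auto
      then have "bdd_above ((\<lambda>z. norm ((deriv ^^ s) f z) / (fact s * l z ^ s)) ` sphere 0 R)"
        by (intro bounded_imp_bdd_above compact_imp_bounded)
      then show ?thesis unfolding bdd_above_def by fastforce
    qed
    then obtain B where B: "\<And>s z. norm z = R \<Longrightarrow> norm ((deriv ^^ s) f z) / (fact s * l z ^ s) \<le> B s"
      by metis
    \<comment> \<open>Inserting 1 ensures that \<open>ln A\<close> is nonnegative.\<close>
    define A where "A = Max (insert 1 (B ` {0..N}))"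
    have A1: "1 \<le> A" unfolding A_def by (intro Max_ge) auto
    have B_A: "B s \<le> A" if "s \<le> N" for s unfolding A_def using that by (intro Max_ge) auto

    have growth_at: "norm (f z) \<le> A * exp ((K + e / 2) * I r)" if r: "R \<le> r" and nz: "norm z = r" for r z
    proof -
      define \<theta> where "\<theta> = Arg2pi z"
      have \<theta>: "\<theta> \<in> {0..2 * pi}"
        using Arg2pi_ge_0[of z] Arg2pi_lt_2pi[of z] by (auto simp: \<theta>_def)
      have z: "z = of_real r * ray \<theta>"
        using Arg2pi_eq[of z] nz by (simp add: \<theta>_def ray_def)
      have "norm (f (of_real r * ray \<theta>)) \<le> A * exp (((c + 1) * real N + 1) * (J \<theta> r - J \<theta> R))"
      proof (rule norm_ray_le[OF f_entire index l_pos norm_ray r, where v' = "\<lambda>t. u' t \<theta>"])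
        show "((\<lambda>x. l (of_real x * ray \<theta>)) has_real_derivative u' t \<theta>) (at t within {R..r})"
          if "t \<in> {R..r}" for t
          using that by (intro has_field_derivative_subset[OF l_deriv[OF _ \<theta>]]) auto
        show "(J \<theta> has_real_derivative l (of_real t * ray \<theta>)) (at t within {R..r})"
          if "t \<in> {R..r}" for t
          using that by (intro has_field_derivative_subset[OF J_deriv_R]) auto
        show "norm ((deriv ^^ s) f (of_real R * ray \<theta>)) / (fact s * l (of_real R * ray \<theta>) ^ s) \<le> A"
          if "s \<le> N" for s
          using B[of "of_real R * ray \<theta>" s] B_A[OF that] R by (simp add: norm_mult norm_ray)
      qed (use c_pos slope \<theta> in auto)
      also have "\<dots> \<le> A * exp ((K + e / 2) * I r)"
      proof -
        \<comment> \<open>The nonnegative \<open>J \<theta> R\<close> is dropped, which only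
          enlarges the exponent.\<close>
        have "((c + 1) * real N + 1) * (J \<theta> r - J \<theta> R) \<le> ((c + 1) * real N + 1) * I r"
          using c_pos J_nonneg[of \<theta> R] J_le[OF \<theta>, of r] r R by (intro mult_left_mono) auto
        also have "\<dots> \<le> (K + e / 2) * I r"
          using K_c J_nonneg[of \<theta> r] J_le[OF \<theta>, of r] r R by (intro mult_right_mono) auto
        finally show ?thesis using A1 by (intro mult_left_mono) auto
      qed
      finally show ?thesis by (simp add: z)
    qed
    have growth: "0 \<le> M r" "M r \<le> A * exp ((K + e / 2) * I r)" if r: "R \<le> r" for r
    proof -
      have mem: "of_real r \<in> {z::complex. norm z = r}" using r R by simp
      have "norm (f (of_real r)) \<le> M r"
        unfolding M_def using growth_at[OF r]
        by (intro cSUP_upper[OF mem] bdd_aboveI2[where M = "A * exp ((K + e / 2) * I r)"]) auto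
      then show "0 \<le> M r" using order.trans[OF norm_ge_zero] by blast
      show "M r \<le> A * exp ((K + e / 2) * I r)"
        unfolding M_def
        by (rule cSUP_least) (use growth_at[OF r] mem in blast)+
    qed

    \<comment> \<open>The bound 1 makes the final division by \<open>I r\<close> legitimate; the
      other bound gives \<open>ln A <= e / 2 * I r\<close>.\<close>
    have "\<forall>\<^sub>F r in at_top. max 1 (2 * ln A / e) \<le> I r"
      using I_at_top unfolding filterlim_at_top by blast
    with eventually_ge_at_top[of R] show ?thesis
    proof eventually_elim
      case (elim r)
      then have I: "1 \<le> I r" and "2 * ln A / e \<le> I r" by simp_all
      then have ln_A: "ln A \<le> e / 2 * I r" using e by (simp add: field_simps)
      have "ln (M r) \<le> ln A + (K + e / 2) * I r"
      proof (cases "M r = 0")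
        case False
        then have "0 < M r" using growth(1)[OF elim(1)] by simp
        then have "ln (M r) \<le> ln (A * exp ((K + e / 2) * I r))"
          using growth(2)[OF elim(1)] by (subst ln_le_cancel_iff) auto
        then show ?thesis using A1 by (simp add: ln_mult)
      next
        case True
        \<comment> \<open>\<open>ln 0 = 0\<close>, so this case (\<open>f = 0\<close>) still needs a nonnegative right-hand side.\<close>
        have "0 \<le> (K + e / 2) * I r" using C_pos e I by (simp add: K_def)
        with True A1 show ?thesis by simp
      qed
      with ln_A have "ln (M r) \<le> (K + e) * I r" by (simp add: algebra_simps)
      with I show ?case by (simp add: pos_divide_le_eq)
    qed
  qed
  have "Limsup at_top (\<lambda>r. ereal (ln (M r) / I r)) \<le> ereal K + ereal e" if "e > 0" for e
    by (rule Limsup_bounded) (use main[OF that] in simp)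
  then have "Limsup at_top (\<lambda>r. ereal (ln (M r) / I r)) \<le> ereal K"
    by (rule ereal_le_epsilon2)
  then show ?thesis
    by (simp only: M_def I_def J_def K_def ray_def)
qed

end
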